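(* There is a quasi-isometric embedding of $\mathbb{H}^2\times\mathbb{H}^2$ into $SL(3,\mathbb{R})/SO(3)$. More generally, for every positive integer $n$ there is a quasi-isometric embedding of the product of $n$ copies of $\mathbb{H}^2$ into $SL(n+1,\mathbb{R})/SO(n+1)$.
   Context: $\mathbb{H}^2$ is the hyperbolic plane; products carry the product Riemannian metric and $SL(n+1,\mathbb{R})/SO(n+1)$ its invariant symmetric metric. A map $f:X\to Y$ of metric spaces is a $(K,C)$-quasi-isometric embedding ($K\ge 1$, $C\ge 0$) if $\frac1K d_X(x_1,x_2)-C\le d_Y(f(x_1),f(x_2))\le K d_X(x_1,x_2)+C$ for all $x_1,x_2\in X$; it is a quasi-isometric embedding if this holds for some $K,C$. *)

theory Defs
  imports "HOL-Analysis.Analysis"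
begin

text \<open>
  A (possibly degenerate) metric tensor on a subset \<open>S\<close> of a normed space is given by its quadratic
  form \<open>q p v\<close>. The library's piecewise C1 curves may have unbounded derivative near the exceptional
  points, and the integral of a non-integrable function is \<open>0\<close>. Hence integrability of the speed,
  i.e. finiteness of the length, is required explicitly.
\<close>

definition curve_length :: "('a::real_normed_vector \<Rightarrow> 'a \<Rightarrow> real) \<Rightarrow> (real \<Rightarrow> 'a) \<Rightarrow> real" where
  "curve_length q \<gamma> = integral {0..1} (\<lambda>t. sqrt (q (\<gamma> t) (vector_derivative \<gamma> (at t))))"

definition rectifiable_curve_in ::
    "'a::real_normed_vector set \<Rightarrow> ('a \<Rightarrow> 'a \<Rightarrow> real) \<Rightarrow> (real \<Rightarrow> 'a) \<Rightarrow> bool" where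
  "rectifiable_curve_in S q \<gamma> \<longleftrightarrow> valid_path \<gamma> \<and> path_image \<gamma> \<subseteq> S \<and>
     (\<lambda>t. sqrt (q (\<gamma> t) (vector_derivative \<gamma> (at t)))) integrable_on {0..1}"

definition riemannian_dist ::
    "'a::real_normed_vector set \<Rightarrow> ('a \<Rightarrow> 'a \<Rightarrow> real) \<Rightarrow> 'a set \<Rightarrow> 'a set \<Rightarrow> real" where
  "riemannian_dist S q A B =
     Inf {curve_length q \<gamma> | \<gamma>. rectifiable_curve_in S q \<gamma> \<and> pathstart \<gamma> \<in> A \<and> pathfinish \<gamma> \<in> B}"

definition hyperbolic_plane :: "complex set" where
  "hyperbolic_plane = {z. Im z > 0}"

definition hyperbolic_tensor :: "complex \<Rightarrow> complex \<Rightarrow> real" where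
  "hyperbolic_tensor z v = (norm v)\<^sup>2 / (Im z)\<^sup>2"

definition hyperbolic_power :: "(complex ^ 'n) set" where
  "hyperbolic_power = {p. \<forall>i. p $ i \<in> hyperbolic_plane}"

definition hyperbolic_power_tensor :: "complex ^ 'n \<Rightarrow> complex ^ 'n \<Rightarrow> real" where
  "hyperbolic_power_tensor p v = (\<Sum>i\<in>UNIV. hyperbolic_tensor (p $ i) (v $ i))"

definition hyperbolic_power_dist :: "complex ^ 'n \<Rightarrow> complex ^ 'n \<Rightarrow> real" where
  "hyperbolic_power_dist x y =
     riemannian_dist hyperbolic_power hyperbolic_power_tensor {x} {y}"

definition SL :: "(real ^ 'm ^ 'm) set" where
  "SL = {g. det g = 1}"

definition SO :: "(real ^ 'm ^ 'm) set" where
  "SO = {k. rotation_matrix k}"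

definition SL_mod_SO :: "(real ^ 'm ^ 'm) set set" where
  "SL_mod_SO = {(\<lambda>k. g ** k) ` SO | g. g \<in> SL}"

text \<open>
  The invariant symmetric metric on the coset space, pulled back to \<open>SL\<close> along the quotient map:
  a tangent vector \<open>v = g X\<close> at \<open>g\<close> projects to the tangent vector of the coset \<open>g SO\<close> represented by
  \<open>X\<close> modulo skew-symmetric matrices, i.e. by its symmetric part \<open>Y\<close>, whose squared length is
  \<open>trace (Y Y)\<close>. This is the normalization by the trace form; the metric is unique up to a
  positive factor.

  The piecewise C1 curves in the coset space are the projections of such curves in \<open>SL\<close>, so the
  Riemannian distance of two cosets is the infimum of the pulled-back lengths of curves in \<open>SL\<close>
  that start in the first coset and end in the second.
\<close>

definition symmetric_space_tensor :: "real ^ 'm ^ 'm \<Rightarrow> real ^ 'm ^ 'm \<Rightarrow> real" where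
  "symmetric_space_tensor g v =
     (let X = matrix_inv g ** v; Y = (1/2) *\<^sub>R (X + transpose X) in trace (Y ** Y))"

definition SL_mod_SO_dist :: "(real ^ 'm ^ 'm) set \<Rightarrow> (real ^ 'm ^ 'm) set \<Rightarrow> real" where
  "SL_mod_SO_dist A B = riemannian_dist SL symmetric_space_tensor A B"

definition quasi_isometric_embedding ::
    "real \<Rightarrow> real \<Rightarrow> 'a set \<Rightarrow> ('a \<Rightarrow> 'a \<Rightarrow> real) \<Rightarrow> 'b set \<Rightarrow> ('b \<Rightarrow> 'b \<Rightarrow> real) \<Rightarrow> ('a \<Rightarrow> 'b) \<Rightarrow> bool" where
  "quasi_isometric_embedding K C X dX Y dY f \<longleftrightarrow>
     K \<ge> 1 \<and> C \<ge> 0 \<and> f \<in> X \<rightarrow> Y \<and>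
     (\<forall>x1\<in>X. \<forall>x2\<in>X. 1 / K * dX x1 x2 - C \<le> dY (f x1) (f x2) \<and>
        dY (f x1) (f x2) \<le> K * dX x1 x2 + C)"

end

theory Submission
  imports Defs
begin

text \<open>
  Write \<open>m = n + 1\<close>. A point \<open>z\<close> of the product, with \<open>z\<^sub>i = x\<^sub>i + i y\<^sub>i\<close>, is sent to the coset of
  the matrix with rows \<open>y\<^sub>i e\<^sub>i + x\<^sub>i e\<^sub>m\<close> and \<open>e\<^sub>m\<close>, rescaled to determinant 1: the diagonal group of
  \<open>SL(m)\<close> together with the abelian unipotent group of the last column is a product of \<open>n\<close> copies of
  the affine group of the line, which acts simply transitively on each hyperbolic plane.
  For this map \<open>g\<close>, the form \<open>g\<^sup>-\<^sup>1 dg\<close> is bounded by the hyperbolic metric, so \<open>g\<close> is Lipschitz.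

  Conversely, for a fixed vector \<open>w \<noteq> 0\<close> the function \<open>ln |w g|\<close> is invariant under right
  multiplication by rotations and 1-Lipschitz. For \<open>w = e\<^sub>i - t e\<^sub>m\<close>, the norm \<open>|w g(z)|\<close> is the scaling
  factor, itself controlled by \<open>w = e\<^sub>m\<close>, times the Euclidean distance from \<open>z\<^sub>i\<close> to the real number
  \<open>t\<close>. If two images have distance at most \<open>L\<close>, these Euclidean distances for \<open>z\<close> and \<open>z'\<close> differ by
  a factor of at most \<open>exp (2 L)\<close>; taking \<open>t = x\<^sub>i\<close> and \<open>t = x'\<^sub>i\<close> this bounds the hyperbolic distance
  linearly in \<open>L\<close>.
\<close>

section \<open>Derivatives of vectors and norms of matrices\<close>

lemma has_vector_derivative_vec_lambda:
  fixes f :: "'n::finite \<Rightarrow> real \<Rightarrow> 'a::euclidean_space"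
  assumes "\<And>i. (f i has_vector_derivative D i) (at t)"
  shows "((\<lambda>t. \<chi> i. f i t) has_vector_derivative (\<chi> i. D i)) (at t)"
  unfolding has_vector_derivative_def
proof (subst has_derivative_componentwise_within, intro ballI)
  fix b :: "'a ^ 'n" assume "b \<in> Basis"
  then obtain i u where b: "b = axis i u"
    by (auto simp: Basis_vec_def)
  show "((\<lambda>t. (\<chi> i. f i t) \<bullet> b) has_derivative (\<lambda>x. x *\<^sub>R (\<chi> i. D i) \<bullet> b)) (at t)"
    using has_derivative_inner_left[OF assms[of i, unfolded has_vector_derivative_def], of u]
    by (simp add: b inner_axis)
qed

text \<open>Here \<open>norm A\<close> is the Frobenius norm; the bound is Cauchy-Schwarz in every
  row.\<close>

lemma norm_matrix_vector_mult_le: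
  fixes A :: "real ^ 'n ^ 'm" and x :: "real ^ 'n"
  shows "norm (A *v x) \<le> norm A * norm x"
proof -
  have "norm (A *v x) \<le> L2_set (\<lambda>i. norm (A $ i) * norm x) UNIV"
    unfolding norm_vec_def[of "A *v x"]
    by (rule L2_set_mono) (auto simp: matrix_vector_mul_component Cauchy_Schwarz_ineq2)
  also have "\<dots> = norm A * norm x"
    by (simp add: norm_vec_def[of A] L2_set_left_distrib)
  finally show ?thesis .
qed

lemma norm_transpose:
  fixes A :: "real ^ 'n ^ 'm"
  shows "norm (transpose A) = norm A"
proof -
  have "transpose A \<bullet> transpose A = A \<bullet> A"
    unfolding inner_vec_def transpose_def by (simp, rule sum.swap)
  then show ?thesis by (simp add: norm_eq_sqrt_inner)
qed

lemma trace_square_symmetric: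
  fixes Y :: "real ^ 'm ^ 'm"
  assumes "transpose Y = Y"
  shows "trace (Y ** Y) = (norm Y)\<^sup>2"
proof -
  have *: "Y $ j $ i = Y $ i $ j" for i j
    using assms by (metis transpose_def vec_lambda_beta)
  have "trace (Y ** Y) = (\<Sum>i\<in>UNIV. \<Sum>j\<in>UNIV. Y $ i $ j * Y $ i $ j)"
    unfolding trace_def matrix_matrix_mult_def by (simp add: *)
  also have "\<dots> = Y \<bullet> Y"
    by (simp add: inner_vec_def)
  finally show ?thesis by (simp add: power2_norm_eq_inner)
qed

lemma matrix_inv_mult_cancel:
  fixes g :: "real ^ 'm ^ 'm"
  assumes "g \<in> SL"
  shows "matrix_inv g ** (g ** X) = X" "g ** (matrix_inv g ** X) = X"
proof -
  have "invertible g"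
    using assms by (simp add: SL_def invertible_det_nz)
  then have "g ** matrix_inv g = mat 1 \<and> matrix_inv g ** g = mat 1"
    unfolding invertible_def matrix_inv_def by (rule someI_ex)
  then show "matrix_inv g ** (g ** X) = X" "g ** (matrix_inv g ** X) = X"
    by (simp_all add: matrix_mul_assoc)
qed

section \<open>Speeds in the symmetric space\<close>

definition sym_part :: "real ^ 'm ^ 'm \<Rightarrow> real ^ 'm ^ 'm" where
  "sym_part X = (1/2) *\<^sub>R (X + transpose X)"

lemma transpose_sym_part: "transpose (sym_part X) = sym_part X"
  by (simp add: sym_part_def transpose_def vec_eq_iff add.commute)

lemma norm_sym_part_le: "norm (sym_part X) \<le> norm X"
  using norm_triangle_ineq[of X "transpose X"] by (simp add: sym_part_def norm_transpose)

text \<open>For symmetric \<open>Y\<close> the trace of \<open>Y ** Y\<close> is the squared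
  Frobenius norm, so speeds in the quotient can be estimated by norm inequalities.\<close>

lemma sqrt_symmetric_space_tensor:
  "sqrt (symmetric_space_tensor g v) = norm (sym_part (matrix_inv g ** v))"
  unfolding symmetric_space_tensor_def Let_def sym_part_def[symmetric]
  by (simp add: trace_square_symmetric transpose_sym_part)

text \<open>The skew-symmetric part of \<open>X\<close> contributes nothing to this quadratic form.
  Only the part of the velocity that is visible in the quotient changes the length of
  \<open>u\<close>.\<close>

lemma inner_vector_matrix_mult_self:
  fixes u :: "real ^ 'm"
  shows "\<bar>u \<bullet> (u v* X)\<bar> \<le> norm (sym_part X) * (norm u)\<^sup>2"
proof -
  have 1: "u \<bullet> (X *v u) = u \<bullet> (u v* X)"
    by (metis dot_lmul_matrix inner_commute)
  have "sym_part X *v u = (1/2) *\<^sub>R (X *v u + u v* X)"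
    by (simp add: sym_part_def scaleR_matrix_vector_assoc[symmetric] matrix_vector_mult_add_rdistrib)
  then have "u \<bullet> (u v* X) = u \<bullet> (sym_part X *v u)"
    by (simp add: inner_add_right 1)
  also have "\<bar>\<dots>\<bar> \<le> norm u * (norm (sym_part X) * norm u)"
    by (rule order_trans[OF Cauchy_Schwarz_ineq2])
      (intro mult_left_mono norm_matrix_vector_mult_le norm_ge_zero)
  finally show ?thesis by (simp add: power2_eq_square mult_ac)
qed

lemma valid_path_vector_derivative:
  assumes "valid_path \<gamma>"
  obtains S where "finite S"
    "\<And>t. t \<in> {0..1} - S \<Longrightarrow> (\<gamma> has_vector_derivative vector_derivative \<gamma> (at t)) (at t)"
    "continuous_on ({0..1} - S) (\<lambda>t. vector_derivative \<gamma> (at t))"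
    "continuous_on {0..1} \<gamma>"
proof -
  from assms obtain S where S: "finite S" "\<gamma> C1_differentiable_on ({0..1} - S)"
    and c: "continuous_on {0..1} \<gamma>"
    by (auto simp: valid_path_def piecewise_C1_differentiable_on_def)
  from S(2) have "\<forall>x\<in>{0..1}-S. \<gamma> differentiable at x"
    "continuous_on ({0..1}-S) (\<lambda>x. vector_derivative \<gamma> (at x))"
    by (auto simp: C1_differentiable_on_eq)
  with S(1) c that show thesis
    by (metis vector_derivative_works)
qed

text \<open>With \<open>X = g^-1 g'\<close> along the curve, \<open>u = w g\<close> satisfies
  \<open>u' = u X\<close>. So \<open>ln |u|\<close> has the derivative
  \<open>(u \<bullet> u X) / |u|^2\<close>, whose absolute value is at most the speed in the
  quotient.\<close>

lemma ln_norm_le_curve_length: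
  fixes \<sigma> :: "real \<Rightarrow> real ^ 'm ^ 'm"
  assumes \<sigma>: "rectifiable_curve_in SL symmetric_space_tensor \<sigma>" and w: "w \<noteq> 0"
  shows "\<bar>ln (norm (w v* pathfinish \<sigma>)) - ln (norm (w v* pathstart \<sigma>))\<bar>
           \<le> curve_length symmetric_space_tensor \<sigma>"
proof -
  let ?s = "\<lambda>t. sqrt (symmetric_space_tensor (\<sigma> t) (vector_derivative \<sigma> (at t)))"
  define u where "u t = w v* \<sigma> t" for t
  define X where "X t = matrix_inv (\<sigma> t) ** vector_derivative \<sigma> (at t)" for t
  from \<sigma> have vp: "valid_path \<sigma>" and im: "path_image \<sigma> \<subseteq> SL" and int: "?s integrable_on {0..1}"
    by (auto simp: rectifiable_curve_in_def)
  obtain S where S: "finite S"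
    and d: "\<And>t. t \<in> {0..1} - S \<Longrightarrow> (\<sigma> has_vector_derivative vector_derivative \<sigma> (at t)) (at t)"
    and c: "continuous_on {0..1} \<sigma>"
    using valid_path_vector_derivative[OF vp] by metis
  have SL: "\<sigma> t \<in> SL" if "t \<in> {0..1}" for t
    using im that by (auto simp: path_image_def)
  have u0: "u t \<noteq> 0" if "t \<in> {0..1}" for t
  proof
    assume "u t = 0"
    then have "w v* (\<sigma> t ** matrix_inv (\<sigma> t)) = 0"
      by (simp add: u_def vector_matrix_mul_assoc[symmetric])
    moreover have "\<sigma> t ** matrix_inv (\<sigma> t) = mat 1"
      using matrix_inv_mult_cancel(2)[OF SL[OF that], of "mat 1"] by simp
    ultimately show False using w by simp
  qed
  have lin: "bounded_linear (\<lambda>A :: real ^ 'm ^ 'm. w v* A)"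
    by (simp add: linear_conv_bounded_linear[symmetric] linear_iff vector_matrix_mult_add_rdistrib
        vector_scaleR_matrix_ac)
  have cu: "continuous_on {0..1} u"
    unfolding u_def by (intro bounded_linear.continuous_on[OF lin] c)
  \<comment> \<open>This is \<open>ln |u|\<close>, written without the square root so that it is
    easily differentiated.\<close>
  define \<phi> where "\<phi> t = ln (u t \<bullet> u t) / 2" for t
  define \<phi>' where "\<phi>' t = (u t \<bullet> (u t v* X t)) / (u t \<bullet> u t)" for t
  have phi: "(\<phi>' has_integral (\<phi> 1 - \<phi> 0)) {0..1}"
  proof (rule fundamental_theorem_of_calculus_interior_strong[OF S])
    fix t assume t: "t \<in> {0<..<1::real} - S"
    then have t': "t \<in> {0..1}" by auto
    have "vector_derivative \<sigma> (at t) = \<sigma> t ** X t"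
      unfolding X_def by (rule matrix_inv_mult_cancel(2)[OF SL[OF t'], symmetric])
    then have "(u has_vector_derivative u t v* X t) (at t)"
      using bounded_linear.has_vector_derivative[OF lin d[of t]] t
      by (simp add: u_def[abs_def] vector_matrix_mul_assoc)
    from bounded_bilinear.has_vector_derivative[OF bounded_bilinear_inner this this]
    have "((\<lambda>t. u t \<bullet> u t) has_real_derivative (2 * (u t \<bullet> (u t v* X t)))) (at t)"
      by (simp add: has_real_derivative_iff_has_vector_derivative inner_commute)
    then show "(\<phi> has_vector_derivative \<phi>' t) (at t)"
      unfolding \<phi>_def \<phi>'_def has_real_derivative_iff_has_vector_derivative[symmetric]
      using u0[OF t'] by (auto intro!: derivative_eq_intros simp: field_simps)
  next
    show "continuous_on {0..1} \<phi>"
      unfolding \<phi>_def by (intro continuous_intros cu) (use u0 in auto)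
  qed simp
  have bd: "\<bar>\<phi>' t\<bar> \<le> ?s t" if "t \<in> {0..1}" for t
    using inner_vector_matrix_mult_self[of "u t" "X t"] u0[OF that]
    by (simp add: \<phi>'_def sqrt_symmetric_space_tensor X_def[symmetric] abs_divide field_simps
        power2_norm_eq_inner)
  have "\<phi> 1 - \<phi> 0 \<le> integral {0..1} ?s"
    using bd by (intro has_integral_le[OF phi integrable_integral[OF int]]) (auto simp: abs_le_iff)
  moreover have "- (\<phi> 1 - \<phi> 0) \<le> integral {0..1} ?s"
    using bd by (intro has_integral_le[OF has_integral_neg[OF phi] integrable_integral[OF int]])
      (auto simp: abs_le_iff)
  moreover have "\<phi> t = ln (norm (u t))" if "t \<in> {0..1}" for t
    using u0[OF that] by (simp add: \<phi>_def norm_eq_sqrt_inner ln_sqrt)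
  ultimately show ?thesis
    by (simp add: curve_length_def u_def pathfinish_def pathstart_def abs_le_iff)
qed

lemma norm_vector_matrix_mult_orthogonal:
  fixes k :: "real ^ 'm ^ 'm"
  assumes "orthogonal_matrix k"
  shows "norm (u v* k) = norm u"
proof -
  have "(u v* k) \<bullet> (u v* k) = u \<bullet> (k *v (transpose k *v u))"
    by (simp add: dot_lmul_matrix)
  also have "\<dots> = u \<bullet> u"
    using assms by (simp add: matrix_vector_mul_assoc orthogonal_matrix_def del: transpose_matrix_vector)
  finally show ?thesis by (simp add: norm_eq_sqrt_inner)
qed

text \<open>Continuity off a finite set gives measurability, and domination by \<open>g\<close> then
  gives integrability. This is for speeds that may be unbounded near the exceptional points of a
  piecewise C1 curve.\<close>

lemma continuous_bounded_imp_integrable: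
  fixes f g :: "real \<Rightarrow> real"
  assumes S: "finite S" and f: "continuous_on ({a..b} - S) f" and g: "g integrable_on {a..b}"
    and le: "\<And>t. t \<in> {a..b} - S \<Longrightarrow> \<bar>f t\<bar> \<le> g t"
  shows "f integrable_on {a..b}"
proof -
  have m: "{a..b} - S \<in> sets lebesgue"
    using S by (auto intro!: sets.Diff simp: finite_imp_closed)
  have neg: "negligible S" using S by (rule negligible_finite)
  have "g integrable_on ({a..b} - S)"
    by (rule integrable_spike_set[OF g]; rule negligible_subset[OF neg]; auto)
  then have "f absolutely_integrable_on ({a..b} - S)"
    using continuous_imp_measurable_on_sets_lebesgue[OF f m] le m
    by (intro measurable_bounded_by_integrable_imp_absolutely_integrable[where g=g]) auto
  then have "f integrable_on ({a..b} - S)"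
    by (simp add: absolutely_integrable_on_def)
  then show ?thesis
    by (rule integrable_spike_set; intro negligible_subset[OF neg]; auto)
qed

section \<open>Short curves in the hyperbolic plane\<close>

text \<open>
  The curve has height \<open>exp u\<close> for a quadratic polynomial \<open>u\<close>, and its horizontal velocity is a
  multiple \<open>\<kappa>\<close> of its height. By Jensen's inequality the integral of \<open>exp u\<close> is at least \<open>exp m\<close>,
  where \<open>m\<close> is the mean of \<open>u\<close>; this gives \<open>|\<kappa>| \<le> 1\<close>.
\<close>

lemma hyperbolic_plane_curve:
  assumes z: "Im z > 0" and z': "Im z' > 0" and \<Lambda>: "\<Lambda> \<ge> 0"
    and ln: "\<bar>ln (Im z') - ln (Im z)\<bar> \<le> \<Lambda>"
    and re: "\<bar>Re z' - Re z\<bar> \<le> exp (\<Lambda> + (ln (Im z) + ln (Im z')) / 2)"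
  shows "\<exists>\<zeta> D. \<zeta> 0 = z \<and> \<zeta> 1 = z' \<and> continuous_on {0..1} D \<and>
    (\<forall>t\<in>{0..1}. (\<zeta> has_vector_derivative D t) (at t) \<and> Im (\<zeta> t) > 0 \<and>
        hyperbolic_tensor (\<zeta> t) (D t) \<le> (7 * \<Lambda> + 1)\<^sup>2)"
proof -
  define a b where "a = ln (Im z)" and "b = ln (Im z') - ln (Im z)"
  define m where "m = a + b / 2 + \<Lambda>"
  \<comment> \<open>The factor 6 gives the parabola the mean \<Lambda> on the unit interval. It
    vanishes at both ends, so \<open>u\<close> joins the logarithms of the two heights and has mean
    \<open>m\<close>. \<open>U\<close> is its antiderivative, with \<open>U 0 = 0\<close> and
    \<open>U 1 = m\<close>.\<close>
  define u where "u t = a + b * t + 6 * \<Lambda> * (t * (1 - t))" for t :: real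
  define U where "U t = a * t + b * t^2 / 2 + \<Lambda> * (3 * t^2 - 2 * t^3)" for t :: real
  \<comment> \<open>The larger interval makes the derivative of \<open>E\<close> two-sided at 0 and
    1 as well.\<close>
  have "continuous_on {-1..2} (\<lambda>t. exp (u t))"
    unfolding u_def by (intro continuous_intros)
  then obtain E where E: "\<And>t. t \<in> {-1..2} \<Longrightarrow> (E has_vector_derivative exp (u t)) (at t within {-1..2})"
    using antiderivative_continuous by blast
  have E': "(E has_real_derivative exp (u t)) (at t)" if "t \<in> {0..1}" for t
    using E[of t] that at_within_Icc_at[of "-1" t 2]
    by (simp add: has_real_derivative_iff_has_vector_derivative)
  \<comment> \<open>Jensen's inequality through the tangent of \<open>exp\<close> at
    \<open>m\<close>: \<open>H\<close> is the integrated difference of \<open>exp (u t)\<close> and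
    the tangent line, hence nondecreasing.\<close>
  define H where "H t = E t - exp m * (t + U t - m * t)" for t
  have "H 0 \<le> H 1"
  proof (rule DERIV_nonneg_imp_nondecreasing[where f = H])
    fix t :: real assume t: "0 \<le> t" "t \<le> 1"
    have "(H has_real_derivative (exp (u t) - exp m * (1 + u t - m))) (at t)"
      unfolding H_def U_def using t
      by (auto intro!: derivative_eq_intros E' simp: u_def field_simps power2_eq_square)
    moreover have "exp m * (1 + (u t - m)) \<le> exp m * exp (u t - m)"
      by (intro mult_left_mono exp_ge_add_one_self) simp
    then have "exp (u t) - exp m * (1 + u t - m) \<ge> 0"
      by (simp add: exp_add[symmetric] algebra_simps)
    ultimately show "\<exists>y. (H has_real_derivative y) (at t) \<and> 0 \<le> y" by blast
  qed simp
  then have Em: "exp m \<le> E 1 - E 0"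
    by (simp add: H_def U_def m_def algebra_simps)
  define \<kappa> where "\<kappa> = (Re z' - Re z) / (E 1 - E 0)"
  have m_eq: "m = \<Lambda> + (ln (Im z) + ln (Im z')) / 2"
    by (simp add: m_def a_def b_def field_simps)
  have E_pos: "E 1 - E 0 > 0"
    using Em exp_gt_zero[of m] by linarith
  have \<kappa>: "\<bar>\<kappa>\<bar> \<le> 1"
    using re Em E_pos by (simp add: \<kappa>_def m_eq abs_divide)
  define \<zeta> where "\<zeta> t = Complex (Re z + \<kappa> * (E t - E 0)) (exp (u t))" for t
  define D where "D t = Complex (\<kappa> * exp (u t)) (exp (u t) * (b + 6 * \<Lambda> * (1 - 2 * t)))" for t
  have "(\<zeta> has_vector_derivative D t) (at t)" if "t \<in> {0..1}" for t
    unfolding \<zeta>_def D_def has_vector_derivative_complex_iff complex.sel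
      has_real_derivative_iff_has_vector_derivative[symmetric] u_def
    using E'[OF that, unfolded u_def]
    by (auto intro!: derivative_eq_intros simp: algebra_simps)
  moreover have "hyperbolic_tensor (\<zeta> t) (D t) \<le> (7 * \<Lambda> + 1)\<^sup>2" if t: "t \<in> {0..1}" for t
  proof -
    \<comment> \<open>Divided by the height, the velocity has the components \<kappa> and
      \<open>c\<close>. The slope \<open>b\<close> contributes at most \<Lambda> to \<open>c\<close>
      and the parabola at most 6 \<Lambda>.\<close>
    define c where "c = b + 6 * \<Lambda> * (1 - 2 * t)"
    have "\<bar>6 * \<Lambda> * (1 - 2 * t)\<bar> \<le> 6 * \<Lambda> * 1"
      unfolding abs_mult using \<Lambda> t by (intro mult_mono) auto
    then have c: "\<bar>c\<bar> \<le> 7 * \<Lambda>"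
      using ln by (simp add: c_def b_def)
    have "D t = exp (u t) *\<^sub>R Complex \<kappa> c"
      by (simp add: D_def c_def complex_eq_iff)
    then have "hyperbolic_tensor (\<zeta> t) (D t) = (norm (Complex \<kappa> c))\<^sup>2"
      by (simp add: hyperbolic_tensor_def \<zeta>_def power_mult_distrib)
    also have "\<dots> \<le> (7 * \<Lambda> + 1)\<^sup>2"
      using cmod_le[of "Complex \<kappa> c"] \<kappa> c by (intro power_mono) auto
    finally show ?thesis .
  qed
  moreover have "continuous_on {0..1} D"
  proof -
    have "D = (\<lambda>t. of_real (\<kappa> * exp (u t)) + \<i> * of_real (exp (u t) * (b + 6 * \<Lambda> * (1 - 2 * t))))"
      by (simp add: D_def fun_eq_iff complex_eq_iff)
    then show ?thesis
      unfolding u_def by (auto intro!: continuous_intros)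
  qed
  moreover have "\<zeta> 0 = z" "\<zeta> 1 = z'"
    using z z' E_pos by (auto simp: \<zeta>_def u_def a_def b_def \<kappa>_def complex_eq_iff)
  moreover have "Im (\<zeta> t) > 0" for t
    by (simp add: \<zeta>_def)
  ultimately show ?thesis by blast
qed

section \<open>Riemannian distances and curves in the product\<close>

lemma curve_length_nonneg:
  assumes "\<And>p v. q p v \<ge> 0"
  shows "curve_length q \<gamma> \<ge> 0"
  unfolding curve_length_def
  \<comment> \<open>If the speed is not integrable, the integral has the default value 0.\<close>
  by (cases "(\<lambda>t. sqrt (q (\<gamma> t) (vector_derivative \<gamma> (at t)))) integrable_on {0..1}")
    (auto intro!: integral_nonneg simp: assms not_integrable_integral)

lemma riemannian_dist_le_curve_length:
  assumes "\<And>p v. q p v \<ge> 0" "rectifiable_curve_in S q \<gamma>" "pathstart \<gamma> \<in> A" "pathfinish \<gamma> \<in> B"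
  shows "riemannian_dist S q A B \<le> curve_length q \<gamma>"
  unfolding riemannian_dist_def
proof (rule cInf_lower)
  show "bdd_below {curve_length q \<gamma> |\<gamma>. rectifiable_curve_in S q \<gamma> \<and> pathstart \<gamma> \<in> A \<and> pathfinish \<gamma> \<in> B}"
    using curve_length_nonneg[of q] assms(1) by (intro bdd_belowI[of _ 0]) auto
qed (use assms in auto)

text \<open>The given curve makes the set of lengths nonempty; the infimum of the empty set would
  carry no information.\<close>

lemma le_riemannian_dist:
  assumes "rectifiable_curve_in S q \<gamma>" "pathstart \<gamma> \<in> A" "pathfinish \<gamma> \<in> B"
    and "\<And>\<gamma>. rectifiable_curve_in S q \<gamma> \<Longrightarrow> pathstart \<gamma> \<in> A \<Longrightarrow> pathfinish \<gamma> \<in> B \<Longrightarrow> c \<le> curve_length q \<gamma>"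
  shows "c \<le> riemannian_dist S q A B"
  unfolding riemannian_dist_def using assms by (intro cInf_greatest) auto

lemma hyperbolic_power_tensor_nonneg: "hyperbolic_power_tensor p v \<ge> 0"
  by (simp add: hyperbolic_power_tensor_def hyperbolic_tensor_def sum_nonneg)

lemma symmetric_space_tensor_nonneg: "symmetric_space_tensor g v \<ge> 0"
  using sqrt_symmetric_space_tensor[of g v] norm_ge_zero real_sqrt_ge_0_iff by metis

text \<open>All coordinates run simultaneously along the curves of
  \<open>hyperbolic_plane_curve\<close>. The square root of \<open>CARD('n)\<close> that arises from
  adding the squared speeds is rounded up to \<open>CARD('n)\<close>.\<close>

lemma hyperbolic_power_curve:
  fixes p p' :: "complex ^ 'n" and \<Lambda> :: real
  assumes p: "p \<in> hyperbolic_power" and p': "p' \<in> hyperbolic_power" and \<Lambda>: "\<Lambda> \<ge> 0"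
    and ln: "\<And>i. \<bar>ln (Im (p' $ i)) - ln (Im (p $ i))\<bar> \<le> \<Lambda>"
    and re: "\<And>i. \<bar>Re (p' $ i) - Re (p $ i)\<bar> \<le> exp (\<Lambda> + (ln (Im (p $ i)) + ln (Im (p' $ i))) / 2)"
  obtains \<gamma> where "rectifiable_curve_in hyperbolic_power hyperbolic_power_tensor \<gamma>"
    "pathstart \<gamma> = p" "pathfinish \<gamma> = p'"
    "curve_length hyperbolic_power_tensor \<gamma> \<le> CARD('n) * (7 * \<Lambda> + 1)"
proof -
  have "\<forall>i. \<exists>\<zeta> D. \<zeta> 0 = p $ i \<and> \<zeta> 1 = p' $ i \<and> continuous_on {0..1} D \<and>
    (\<forall>t\<in>{0..1}. (\<zeta> has_vector_derivative D t) (at t) \<and> Im (\<zeta> t) > 0 \<and>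
        hyperbolic_tensor (\<zeta> t) (D t) \<le> (7 * \<Lambda> + 1)\<^sup>2)"
    using p p' by (intro allI hyperbolic_plane_curve \<Lambda> ln re)
      (auto simp: hyperbolic_power_def hyperbolic_plane_def)
  then obtain \<zeta> D where ends: "\<And>i. \<zeta> i 0 = p $ i" "\<And>i. \<zeta> i 1 = p' $ i"
    and cD: "\<And>i. continuous_on {0..1} (D i)"
    and d: "\<And>i t. t \<in> {0..1} \<Longrightarrow> (\<zeta> i has_vector_derivative D i t) (at t)"
    and pos: "\<And>i t. t \<in> {0..1} \<Longrightarrow> Im (\<zeta> i t) > 0"
    and le: "\<And>i t. t \<in> {0..1} \<Longrightarrow> hyperbolic_tensor (\<zeta> i t) (D i t) \<le> (7 * \<Lambda> + 1)\<^sup>2"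
    by metis
  define \<gamma> where "\<gamma> t = (\<chi> i. \<zeta> i t)" for t
  define \<gamma>' where "\<gamma>' t = (\<chi> i. D i t)" for t
  have d\<gamma>: "(\<gamma> has_vector_derivative \<gamma>' t) (at t)" if "t \<in> {0..1}" for t
    unfolding \<gamma>_def \<gamma>'_def by (intro has_vector_derivative_vec_lambda d that)
  have vd: "vector_derivative \<gamma> (at t) = \<gamma>' t" if "t \<in> {0..1}" for t
    using d\<gamma>[OF that] by (rule vector_derivative_at)
  have cD': "continuous_on {0..1} \<gamma>'"
    unfolding \<gamma>'_def by (intro continuous_intros cD)
  have c\<zeta>: "continuous_on {0..1} (\<zeta> i)" for i
    by (rule continuous_on_vector_derivative[of _ _ "D i"]) (blast intro: has_vector_derivative_at_within d)
  have vp: "valid_path \<gamma>"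
    unfolding valid_path_def
    by (rule C1_differentiable_imp_piecewise)
      (unfold C1_differentiable_on_def, rule exI[of _ \<gamma>'], intro conjI ballI d\<gamma> cD')
  let ?s = "\<lambda>t. sqrt (hyperbolic_power_tensor (\<gamma> t) (vector_derivative \<gamma> (at t)))"
  have "continuous_on {0..1} (\<lambda>t. sqrt (hyperbolic_power_tensor (\<gamma> t) (\<gamma>' t)))"
    unfolding hyperbolic_power_tensor_def hyperbolic_tensor_def \<gamma>_def \<gamma>'_def
    by (simp, intro continuous_intros cD c\<zeta>) (use pos in \<open>simp, metis less_irrefl\<close>)
  then have int: "?s integrable_on {0..1}"
    by (intro integrable_continuous_real) (rule continuous_on_eq, simp_all add: vd)
  have "?s t \<le> CARD('n) * (7 * \<Lambda> + 1)" if t: "t \<in> {0..1}" for t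
  proof (rule real_le_lsqrt)
    have "hyperbolic_power_tensor (\<gamma> t) (\<gamma>' t) \<le> (\<Sum>i\<in>(UNIV :: 'n set). (7 * \<Lambda> + 1)\<^sup>2)"
      unfolding hyperbolic_power_tensor_def using le[OF t]
      by (intro sum_mono) (simp add: \<gamma>_def \<gamma>'_def)
    also have "\<dots> = CARD('n) * (7 * \<Lambda> + 1)\<^sup>2" by simp
    also have "\<dots> \<le> (CARD('n))\<^sup>2 * (7 * \<Lambda> + 1)\<^sup>2"
    proof (rule mult_right_mono)
      have "CARD('n) \<le> (CARD('n))\<^sup>2" by (simp add: power2_eq_square)
      then show "real CARD('n) \<le> real ((CARD('n))\<^sup>2)" by (rule of_nat_mono)
    qed simp
    finally show "hyperbolic_power_tensor (\<gamma> t) (vector_derivative \<gamma> (at t)) \<le> (CARD('n) * (7 * \<Lambda> + 1))\<^sup>2"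
      by (simp only: vd[OF t] power_mult_distrib of_nat_power)
  qed (use \<Lambda> in auto)
  then have "integral {0..1} ?s \<le> integral {0..1} (\<lambda>t::real. CARD('n) * (7 * \<Lambda> + 1))"
    by (intro integral_le int) auto
  then have "curve_length hyperbolic_power_tensor \<gamma> \<le> CARD('n) * (7 * \<Lambda> + 1)"
    by (simp add: curve_length_def)
  moreover have "rectifiable_curve_in hyperbolic_power hyperbolic_power_tensor \<gamma>"
    using vp int pos
    by (auto simp: rectifiable_curve_in_def path_image_def hyperbolic_power_def hyperbolic_plane_def \<gamma>_def)
  ultimately show thesis
    by (intro that) (simp_all add: pathstart_def pathfinish_def \<gamma>_def ends vec_eq_iff)
qed

section \<open>Determinants, matrix units and connectedness of the product\<close>

text \<open>Only the identity contributes to the determinant. If a permutation sent every moved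
  index to \<open>l\<close>, it would have to fix \<open>l\<close> and could then move no index, by
  injectivity.\<close>

lemma det_diagonal_column:
  fixes A :: "'a::comm_ring_1 ^ 'm ^ 'm"
  assumes A: "\<And>i j. i \<noteq> j \<Longrightarrow> j \<noteq> l \<Longrightarrow> A $ i $ j = 0"
  shows "det A = (\<Prod>i\<in>UNIV. A $ i $ i)"
proof -
  have "(\<Prod>i\<in>UNIV. A $ i $ p i) = 0" if p: "p permutes UNIV" "p \<noteq> id" for p
  proof -
    have "\<exists>i. p i \<noteq> i \<and> p i \<noteq> l"
    proof (rule ccontr)
      assume *: "\<nexists>i. p i \<noteq> i \<and> p i \<noteq> l"
      from p(2) obtain i where "p i \<noteq> i" by fastforce
      with * have "p i = l" "i \<noteq> l" "p l = l" by metis+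
      with p(1) show False by (metis permutes_def)
    qed
    then show ?thesis using A by (metis (no_types, lifting) UNIV_I finite prod_zero)
  qed
  then have "det A = (\<Sum>p\<in>{id}. of_int (sign p) * (\<Prod>i\<in>UNIV. A $ i $ p i))"
    unfolding det_def by (intro sum.mono_neutral_right) (auto simp: permutes_id)
  then show ?thesis by (simp add: sign_id)
qed

lemma axis_one_vector_matrix_mult:
  fixes A :: "real ^ 'n ^ 'm"
  shows "axis i 1 v* A = A $ i"
  by (simp add: vector_matrix_mult_def vec_eq_iff axis_def if_distrib[of "\<lambda>x. x * _"] cong: if_cong)

text \<open>As a matrix, \<open>axis i v\<close> has \<open>v\<close> as its row \<open>i\<close>
  and zeros elsewhere.\<close>

lemma matrix_mult_axis:
  fixes A :: "real ^ 'm ^ 'k" and v :: "real ^ 'n"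
  shows "(A ** axis i v) $ r = (A $ r $ i) *\<^sub>R v"
  by (simp add: matrix_matrix_mult_def vec_eq_iff axis_def if_distrib[of "\<lambda>x. x $ _"]
      if_distrib[of "\<lambda>x. _ * x"] cong: if_cong)

lemma matrix_mult_sum_right:
  fixes A :: "real ^ 'm ^ 'k" and F :: "'i \<Rightarrow> real ^ 'n ^ 'm"
  shows "A ** (\<Sum>i\<in>I. F i) = (\<Sum>i\<in>I. A ** F i)"
  by (induction I rule: infinite_finite_induct) (auto simp: matrix_add_ldistrib)

text \<open>The coefficients appear in reverse order because the diagonal entry of a row of the
  embedding is the imaginary part.\<close>

lemma norm_scaleR_axis_add:
  assumes "i \<noteq> j"
  shows "norm (a *\<^sub>R axis i 1 + b *\<^sub>R axis j 1 :: real ^ 'm) = cmod (Complex b a)"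
  unfolding norm_eq_sqrt_inner[of "_ + _"] cmod_def complex.sel
  using assms by (simp add: inner_add_left inner_add_right inner_axis_axis power2_eq_square)

lemma det_scaleR: "det (c *\<^sub>R (A :: real ^ 'm ^ 'm)) = c ^ CARD('m) * det A"
  using det_rows_mul[of "\<lambda>_. c" "\<lambda>i. A $ i"]
  by (simp add: scalar_mult_eq_scaleR scaleR_vec_def)

text \<open>Any two points satisfy the hypotheses of \<open>hyperbolic_power_curve\<close> once
  \<Lambda> is large enough. This shows that the infimum defining the distance is over a nonempty
  set.\<close>

lemma hyperbolic_power_connected:
  fixes p p' :: "complex ^ 'n"
  assumes p: "p \<in> hyperbolic_power" and p': "p' \<in> hyperbolic_power"
  obtains \<gamma> where "rectifiable_curve_in hyperbolic_power hyperbolic_power_tensor \<gamma>"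
    "pathstart \<gamma> = p" "pathfinish \<gamma> = p'"
proof -
  define F where "F i = \<bar>ln (Im (p' $ i)) - ln (Im (p $ i))\<bar> +
    \<bar>ln \<bar>Re (p' $ i) - Re (p $ i)\<bar> - (ln (Im (p $ i)) + ln (Im (p' $ i))) / 2\<bar>" for i
  define \<Lambda> where "\<Lambda> = (\<Sum>i\<in>UNIV. F i)"
  have F: "F i \<le> \<Lambda>" for i
    unfolding \<Lambda>_def by (intro member_le_sum) (auto simp: F_def)
  have "\<Lambda> \<ge> 0"
    unfolding \<Lambda>_def by (intro sum_nonneg) (auto simp: F_def)
  moreover have "\<bar>ln (Im (p' $ i)) - ln (Im (p $ i))\<bar> \<le> \<Lambda>" for i
    using F[of i] by (simp add: F_def)
  moreover have "\<bar>Re (p' $ i) - Re (p $ i)\<bar> \<le> exp (\<Lambda> + (ln (Im (p $ i)) + ln (Im (p' $ i))) / 2)" for i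
  \<comment> \<open>For equal real parts the logarithm in \<open>F\<close> is the default value
    \<open>ln 0\<close>, but then the left side is 0.\<close>
  proof (cases "Re (p' $ i) = Re (p $ i)")
    case False
    then have "\<bar>Re (p' $ i) - Re (p $ i)\<bar> = exp (ln \<bar>Re (p' $ i) - Re (p $ i)\<bar>)" by simp
    also have "\<dots> \<le> exp (\<Lambda> + (ln (Im (p $ i)) + ln (Im (p' $ i))) / 2)"
      using F[of i] unfolding F_def by (subst exp_le_cancel_iff) linarith
    finally show ?thesis .
  qed simp
  ultimately show thesis
    by (rule hyperbolic_power_curve[OF p p']) (rule that)
qed

text \<open>The index \<open>l\<close> stands for the last row and column, and \<open>e\<close>
  numbers the others by the factors of the product. This expresses \<open>m = n + 1\<close> on the
  level of index types.\<close>

locale last_index =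
  fixes e :: "'n::finite \<Rightarrow> 'm::finite" and l :: 'm
  assumes inj_e: "inj e" and range_e: "range e = - {l}"
begin

lemma e_neq_l [simp]: "e i \<noteq> l" "l \<noteq> e i"
  using range_e by (metis ComplD insertI1 rangeI)+

lemma e_eq_iff [simp]: "e i = e j \<longleftrightarrow> i = j"
  using inj_e by (auto dest: injD)

lemma index_cases: obtains "r = l" | i where "r = e i"
  using range_e by (metis ComplI imageE singletonD)

section \<open>The matrices of the embedding\<close>

definition arrow_matrix :: "complex ^ 'n \<Rightarrow> real ^ 'm ^ 'm" where
  "arrow_matrix p = axis l (axis l 1) +
     (\<Sum>i\<in>UNIV. Im (p $ i) *\<^sub>R axis (e i) (axis (e i) 1) + Re (p $ i) *\<^sub>R axis (e i) (axis l 1))"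

text \<open>The product of the heights to the power \<open>-1 / CARD('m)\<close>, which normalizes
  the determinant. Through \<open>exp\<close> it is positive everywhere.\<close>

definition det_scale :: "complex ^ 'n \<Rightarrow> real" where
  "det_scale p = exp (- (\<Sum>i\<in>UNIV. ln (Im (p $ i))) / CARD('m))"

definition solvable_matrix :: "complex ^ 'n \<Rightarrow> real ^ 'm ^ 'm" where
  "solvable_matrix p = det_scale p *\<^sub>R arrow_matrix p"

lemma det_scale_pos: "det_scale p > 0"
  by (simp add: det_scale_def)

lemma arrow_matrix_row_l: "arrow_matrix p $ l = axis l 1"
  by (simp add: arrow_matrix_def, simp add: axis_def)

lemma arrow_matrix_row_e:
  "arrow_matrix p $ e i = Im (p $ i) *\<^sub>R axis (e i) 1 + Re (p $ i) *\<^sub>R axis l 1"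
proof -
  have *: "axis (e j) v $ e i = (if j = i then v else 0)" for j and v :: "real ^ 'm"
    by (simp add: axis_def)
  have "axis l v $ e i = 0" for v :: "real ^ 'm"
    by (simp add: axis_def)
  then show ?thesis
    by (simp add: arrow_matrix_def * sum.distrib if_distrib[of "\<lambda>x. _ *\<^sub>R x"] cong: if_cong)
qed

lemma det_arrow_matrix: "det (arrow_matrix p) = (\<Prod>i\<in>UNIV. Im (p $ i))"
proof -
  have UNIV_eq: "(UNIV :: 'm set) = insert l (range e)"
    using range_e by auto
  have "det (arrow_matrix p) = (\<Prod>r\<in>UNIV. arrow_matrix p $ r $ r)"
  proof (rule det_diagonal_column[where l = l])
    fix r c assume "r \<noteq> c" "c \<noteq> l"
    then show "arrow_matrix p $ r $ c = 0"
      by (cases r rule: index_cases) (auto simp: arrow_matrix_row_l arrow_matrix_row_e axis_def)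
  qed
  also have "\<dots> = (\<Prod>i\<in>UNIV. arrow_matrix p $ e i $ e i)"
    unfolding UNIV_eq using inj_e
    by (subst prod.insert) (auto simp: arrow_matrix_row_l prod.reindex)
  finally show ?thesis
    by (simp add: arrow_matrix_row_e, simp add: axis_def)
qed

lemma solvable_matrix_in_SL:
  assumes "p \<in> hyperbolic_power"
  shows "solvable_matrix p \<in> SL"
proof -
  have pos: "Im (p $ i) > 0" for i
    using assms by (auto simp: hyperbolic_power_def hyperbolic_plane_def)
  have "det_scale p ^ CARD('m) = exp (- (\<Sum>i\<in>UNIV. ln (Im (p $ i))))"
    unfolding det_scale_def exp_of_nat_mult[symmetric] by simp
  also have "\<dots> = inverse (\<Prod>i\<in>UNIV. Im (p $ i))"
    using pos by (simp add: exp_minus exp_sum)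
  finally show ?thesis
    using pos by (simp add: SL_def solvable_matrix_def det_scaleR det_arrow_matrix less_imp_neq[symmetric])
qed

section \<open>The upper bound: the embedding is Lipschitz\<close>

definition log_derivative :: "complex ^ 'n \<Rightarrow> complex ^ 'n \<Rightarrow> real ^ 'm ^ 'm" where
  "log_derivative p v = (- (\<Sum>i\<in>UNIV. Im (v $ i) / Im (p $ i)) / CARD('m)) *\<^sub>R mat 1 +
     (\<Sum>i\<in>UNIV. (Im (v $ i) / Im (p $ i)) *\<^sub>R axis (e i) (axis (e i) 1) +
               (Re (v $ i) / Im (p $ i)) *\<^sub>R axis (e i) (axis l 1))"

text \<open>Column \<open>e i\<close> of the arrow matrix has only its diagonal entry, so left
  multiplication scales these matrix units. Hence both terms for \<open>i\<close> in
  \<open>log_derivative\<close> have the denominator \<open>Im (p $ i)\<close>.\<close>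

lemma arrow_matrix_mult_axis: "arrow_matrix p ** axis (e i) v = Im (p $ i) *\<^sub>R axis (e i) v"
proof -
  have "(arrow_matrix p ** axis (e i) v) $ r = Im (p $ i) *\<^sub>R axis (e i) v $ r" for r
    unfolding matrix_mult_axis
    by (cases r rule: index_cases)
      (auto simp: arrow_matrix_row_l arrow_matrix_row_e axis_def)
  then show ?thesis by (simp add: vec_eq_iff)
qed

text \<open>Product rule: in \<open>log_derivative\<close>, which is the form
  \<open>g^-1 dg\<close>, the multiple of the identity comes from \<open>det_scale\<close> and the
  sum from \<open>arrow_matrix\<close>.\<close>

lemma solvable_matrix_has_vector_derivative:
  assumes \<gamma>: "(\<gamma> has_vector_derivative v) (at t)" and p: "\<gamma> t \<in> hyperbolic_power"
  shows "((\<lambda>t. solvable_matrix (\<gamma> t)) has_vector_derivative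
           solvable_matrix (\<gamma> t) ** log_derivative (\<gamma> t) v) (at t)"
proof -
  have pos: "Im (\<gamma> t $ i) > 0" for i
    using p by (auto simp: hyperbolic_power_def hyperbolic_plane_def)
  have nth: "((\<lambda>t. \<gamma> t $ i) has_vector_derivative v $ i) (at t)" for i
    using bounded_linear.has_vector_derivative[OF bounded_linear_vec_nth \<gamma>] .
  define a where "a = (- (\<Sum>i\<in>UNIV. Im (v $ i) / Im (\<gamma> t $ i)) / CARD('m))"
  define N where "N = (\<Sum>i\<in>UNIV. Im (v $ i) *\<^sub>R axis (e i) (axis (e i) 1) +
               Re (v $ i) *\<^sub>R axis (e i) (axis l 1 :: real ^ 'm))"
  have d: "((\<lambda>t. det_scale (\<gamma> t)) has_real_derivative det_scale (\<gamma> t) * a) (at t)"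
    unfolding det_scale_def a_def using pos
    by (auto intro!: derivative_eq_intros nth simp: divide_simps)
  have A: "((\<lambda>t. arrow_matrix (\<gamma> t)) has_vector_derivative N) (at t)"
    unfolding arrow_matrix_def N_def
    by (auto intro!: derivative_eq_intros nth)
  have "arrow_matrix (\<gamma> t) ** log_derivative (\<gamma> t) v = a *\<^sub>R arrow_matrix (\<gamma> t) + N"
    using pos unfolding log_derivative_def a_def[symmetric] N_def
    by (simp add: matrix_add_ldistrib matrix_mult_sum_right matrix_scalar_ac
        scalar_matrix_assoc[symmetric] arrow_matrix_mult_axis less_imp_neq[symmetric])
  then have "solvable_matrix (\<gamma> t) ** log_derivative (\<gamma> t) v =
      det_scale (\<gamma> t) *\<^sub>R N + (det_scale (\<gamma> t) * a) *\<^sub>R arrow_matrix (\<gamma> t)"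
    by (simp add: solvable_matrix_def scalar_matrix_assoc[symmetric] scaleR_add_right add.commute)
  then show ?thesis
    unfolding solvable_matrix_def using has_vector_derivative_scaleR[OF d A] by simp
qed

text \<open>The norm of the identity accounts for the scalar part of \<open>log_derivative\<close>,
  the 2 for the two matrix units of each coordinate.\<close>

definition speed_factor :: real where
  "speed_factor = CARD('n) * (norm (mat 1 :: real ^ 'm ^ 'm) + 2)"

lemma norm_log_derivative_le:
  assumes p: "p \<in> hyperbolic_power"
  shows "norm (log_derivative p v) \<le> speed_factor * sqrt (hyperbolic_power_tensor p v)"
proof -
  let ?s = "sqrt (hyperbolic_power_tensor p v)"
  have pos: "Im (p $ i) > 0" for i
    using p by (auto simp: hyperbolic_power_def hyperbolic_plane_def)
  have s: "norm (v $ i) / Im (p $ i) \<le> ?s" for i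
  proof (rule real_le_rsqrt)
    have "(norm (v $ i) / Im (p $ i))\<^sup>2 = hyperbolic_tensor (p $ i) (v $ i)"
      by (simp add: hyperbolic_tensor_def power_divide)
    also have "\<dots> \<le> hyperbolic_power_tensor p v"
      unfolding hyperbolic_power_tensor_def
      by (intro member_le_sum) (auto simp: hyperbolic_tensor_def)
    finally show "(norm (v $ i) / Im (p $ i))\<^sup>2 \<le> hyperbolic_power_tensor p v" .
  qed
  have re: "\<bar>Re (v $ i) / Im (p $ i)\<bar> \<le> ?s" and im: "\<bar>Im (v $ i) / Im (p $ i)\<bar> \<le> ?s" for i
    using pos[of i] abs_Re_le_cmod[of "v $ i"] abs_Im_le_cmod[of "v $ i"]
    by (auto intro!: order_trans[OF _ s[of i]] divide_right_mono simp: abs_divide)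
  have "\<bar>\<Sum>i\<in>UNIV. Im (v $ i) / Im (p $ i)\<bar> \<le> (\<Sum>i\<in>(UNIV :: 'n set). ?s)"
    by (rule order_trans[OF sum_abs]) (intro sum_mono im)
  then have "\<bar>\<Sum>i\<in>UNIV. Im (v $ i) / Im (p $ i)\<bar> / CARD('m) \<le> CARD('n) * ?s / 1"
    by (intro frac_le) auto
  then have "norm ((- (\<Sum>i\<in>UNIV. Im (v $ i) / Im (p $ i)) / CARD('m)) *\<^sub>R (mat 1 :: real ^ 'm ^ 'm))
      \<le> CARD('n) * ?s * norm (mat 1 :: real ^ 'm ^ 'm)"
    by (simp add: mult_right_mono del: times_divide_eq_left)
  moreover have "norm (\<Sum>i\<in>UNIV. (Im (v $ i) / Im (p $ i)) *\<^sub>R axis (e i) (axis (e i) 1) +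
               (Re (v $ i) / Im (p $ i)) *\<^sub>R axis (e i) (axis l 1 :: real ^ 'm)) \<le> (\<Sum>i\<in>(UNIV :: 'n set). 2 * ?s)"
  proof (rule order_trans[OF norm_sum], rule sum_mono)
    have na: "norm (axis i (axis j 1) :: real ^ 'm ^ 'm) = 1" for i j
      by (rule norm_Basis) simp
    fix i
    show "norm ((Im (v $ i) / Im (p $ i)) *\<^sub>R axis (e i) (axis (e i) 1) +
               (Re (v $ i) / Im (p $ i)) *\<^sub>R axis (e i) (axis l 1 :: real ^ 'm)) \<le> 2 * ?s"
      by (rule order_trans[OF norm_triangle_ineq])
        (use re[of i] im[of i] in \<open>simp only: norm_scaleR na mult_1_right\<close>)
  qed
  ultimately show ?thesis
    unfolding log_derivative_def speed_factor_def
    by (intro order_trans[OF norm_triangle_ineq]) (simp add: algebra_simps)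
qed

text \<open>The speed of the image curve is the norm of the symmetric part of
  \<open>log_derivative\<close>, which \<open>norm_log_derivative_le\<close> bounds by the
  hyperbolic speed. The same bound makes it integrable.\<close>

lemma solvable_matrix_curve:
  assumes \<gamma>: "rectifiable_curve_in hyperbolic_power hyperbolic_power_tensor \<gamma>"
  shows "rectifiable_curve_in SL symmetric_space_tensor (solvable_matrix \<circ> \<gamma>)"
    and "curve_length symmetric_space_tensor (solvable_matrix \<circ> \<gamma>)
           \<le> speed_factor * curve_length hyperbolic_power_tensor \<gamma>"
proof -
  let ?\<sigma> = "solvable_matrix \<circ> \<gamma>"
  let ?s = "\<lambda>t. sqrt (hyperbolic_power_tensor (\<gamma> t) (vector_derivative \<gamma> (at t)))"
  let ?r = "\<lambda>t. sqrt (symmetric_space_tensor (?\<sigma> t) (vector_derivative ?\<sigma> (at t)))"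
  define X where "X t = log_derivative (\<gamma> t) (vector_derivative \<gamma> (at t))" for t
  from \<gamma> have vp: "valid_path \<gamma>" and im: "path_image \<gamma> \<subseteq> hyperbolic_power"
    and int: "?s integrable_on {0..1}"
    by (auto simp: rectifiable_curve_in_def)
  obtain S where S: "finite S"
    and d: "\<And>t. t \<in> {0..1} - S \<Longrightarrow> (\<gamma> has_vector_derivative vector_derivative \<gamma> (at t)) (at t)"
    and cd: "continuous_on ({0..1} - S) (\<lambda>t. vector_derivative \<gamma> (at t))"
    and c: "continuous_on {0..1} \<gamma>"
    using valid_path_vector_derivative[OF vp] by metis
  have H: "\<gamma> t \<in> hyperbolic_power" if "t \<in> {0..1}" for t
    using im that by (auto simp: path_image_def)
  have pos: "Im (\<gamma> t $ i) > 0" if "t \<in> {0..1}" for t i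
    using H[OF that] by (auto simp: hyperbolic_power_def hyperbolic_plane_def)
  have d\<sigma>: "(?\<sigma> has_vector_derivative ?\<sigma> t ** X t) (at t)" if "t \<in> {0..1} - S" for t
    using solvable_matrix_has_vector_derivative[OF d[OF that] H] that
    by (simp add: o_def X_def)
  have c': "continuous_on ({0..1} - S) \<gamma>"
    using c by (rule continuous_on_subset) auto
  have cA: "continuous_on T (\<lambda>t. solvable_matrix (\<gamma> t))" if "continuous_on T \<gamma>" "T \<subseteq> {0..1}" for T
    unfolding solvable_matrix_def det_scale_def arrow_matrix_def
    using that pos by (intro continuous_intros) (auto simp: less_imp_neq[symmetric] subset_iff)
  have cX: "continuous_on ({0..1} - S) X"
    unfolding X_def log_derivative_def
    using pos by (intro continuous_intros c' cd) (auto simp: less_imp_neq[symmetric])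
  have mm: "continuous_on T (\<lambda>t. F t ** G t)"
    if "continuous_on T F" "continuous_on T G" for T and F G :: "real \<Rightarrow> real ^ 'm ^ 'm"
    unfolding matrix_matrix_mult_def by (intro continuous_intros that)
  have "?\<sigma> C1_differentiable_on ({0..1} - S)"
    unfolding C1_differentiable_on_def
    using d\<sigma> mm[OF cA[OF c'] cX] by (intro exI[of _ "\<lambda>t. ?\<sigma> t ** X t"]) auto
  then have vp\<sigma>: "valid_path ?\<sigma>"
    unfolding valid_path_def piecewise_C1_differentiable_on_def
    using S cA[OF c] by (auto simp: o_def)
  have r: "?r t = norm (sym_part (X t))" if "t \<in> {0..1} - S" for t
  proof -
    from that have "?\<sigma> t \<in> SL"
      using solvable_matrix_in_SL[OF H] by simp
    then show ?thesis
      by (simp only: sqrt_symmetric_space_tensor vector_derivative_at[OF d\<sigma>[OF that]] matrix_inv_mult_cancel)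
  qed
  have le: "?r t \<le> speed_factor * ?s t" if "t \<in> {0..1} - S" for t
    unfolding r[OF that] X_def
    using that by (intro order_trans[OF norm_sym_part_le] norm_log_derivative_le H) auto
  have "continuous_on ({0..1} - S) (\<lambda>t. norm (sym_part (X t)))"
    unfolding sym_part_def transpose_def by (intro continuous_intros cX)
  then have "continuous_on ({0..1} - S) ?r"
    by (simp only: r cong: continuous_on_cong)
  moreover have int': "(\<lambda>t. speed_factor * ?s t) integrable_on {0..1}"
    by (rule integrable_on_mult_right[OF int])
  ultimately have int\<sigma>: "?r integrable_on {0..1}"
  proof (rule continuous_bounded_imp_integrable[OF S])
    fix t assume "t \<in> {0..1} - S"
    then show "\<bar>?r t\<bar> \<le> speed_factor * ?s t"
      using le[of t] r[of t] by simp
  qed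
  show "rectifiable_curve_in SL symmetric_space_tensor ?\<sigma>"
    unfolding rectifiable_curve_in_def using vp\<sigma> int\<sigma> solvable_matrix_in_SL[OF H]
    by (auto simp: path_image_def)
  \<comment> \<open>The bound on the speed is available only off the finite set \<open>S\<close>,
    which is negligible.\<close>
  have "integral {0..1} ?r = integral ({0..1} - S) ?r"
    by (rule integral_spike_set; rule negligible_subset[OF negligible_finite[OF S]]; auto)
  also have "\<dots> \<le> integral ({0..1} - S) (\<lambda>t. speed_factor * ?s t)"
  proof (rule integral_le)
    show "?r integrable_on {0..1} - S"
      by (rule integrable_spike_set[OF int\<sigma>]; rule negligible_subset[OF negligible_finite[OF S]]; auto)
    show "(\<lambda>t. speed_factor * ?s t) integrable_on {0..1} - S"
      by (rule integrable_spike_set[OF int']; rule negligible_subset[OF negligible_finite[OF S]]; auto)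
  qed (rule le)
  also have "\<dots> = integral {0..1} (\<lambda>t. speed_factor * ?s t)"
    by (rule integral_spike_set; rule negligible_subset[OF negligible_finite[OF S]]; auto)
  finally show "curve_length symmetric_space_tensor ?\<sigma> \<le> speed_factor * curve_length hyperbolic_power_tensor \<gamma>"
    by (simp add: curve_length_def)
qed

section \<open>The lower bound: recovering points from norms of vectors\<close>

lemma norm_axis_l_solvable_matrix: "norm (axis l 1 v* solvable_matrix p) = det_scale p"
  by (simp add: axis_one_vector_matrix_mult solvable_matrix_def arrow_matrix_row_l det_scale_pos less_imp_le)

text \<open>Subtracting \<open>t\<close> times row \<open>l\<close> from row \<open>e i\<close>
  shifts just the real part of \<open>p $ i\<close> by \<open>t\<close>.\<close>

lemma norm_axis_e_solvable_matrix:
  "norm ((axis (e i) 1 - t *\<^sub>R axis l 1) v* solvable_matrix p) = det_scale p * cmod (p $ i - of_real t)"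
proof -
  have "(axis (e i) 1 - t *\<^sub>R axis l 1) v* solvable_matrix p
      = det_scale p *\<^sub>R (Im (p $ i) *\<^sub>R axis (e i) 1 + (Re (p $ i) - t) *\<^sub>R axis l 1)"
    by (simp add: vector_matrix_mult_diff_distrib scaleR_vector_matrix_assoc axis_one_vector_matrix_mult
        solvable_matrix_def arrow_matrix_row_l arrow_matrix_row_e algebra_simps)
  also have "norm \<dots> = det_scale p * cmod (Complex (Re (p $ i) - t) (Im (p $ i)))"
    using norm_scaleR_axis_add[of "e i" l] det_scale_pos[of p] by (simp add: less_imp_le)
  also have "Complex (Re (p $ i) - t) (Im (p $ i)) = p $ i - of_real t"
    by (simp add: complex_eq_iff)
  finally show ?thesis .
qed

definition coset_embedding :: "complex ^ 'n \<Rightarrow> (real ^ 'm ^ 'm) set" where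
  "coset_embedding p = (\<lambda>k. solvable_matrix p ** k) ` SO"

lemma solvable_matrix_in_coset: "solvable_matrix p \<in> coset_embedding p"
  unfolding coset_embedding_def SO_def rotation_matrix_def
  by (rule image_eqI[of _ _ "mat 1"]) (auto simp: orthogonal_matrix_id)

lemma norm_vector_coset:
  assumes "h \<in> coset_embedding p"
  shows "norm (w v* h) = norm (w v* solvable_matrix p)"
  using assms by (auto simp: coset_embedding_def SO_def rotation_matrix_def
      vector_matrix_mul_assoc[symmetric] norm_vector_matrix_mult_orthogonal)

text \<open>The logarithm of \<open>det_scale\<close> changes by at most \<open>L\<close>, and so
  does that of its product with the distance to \<open>t\<close>; the latter distance alone
  therefore changes by at most \<open>2 * L\<close> on the logarithmic scale. The constant 14 is
  \<open>7 * 2\<close>, from \<open>hyperbolic_power_curve\<close> with \<open>2 * L\<close> for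
  \<Lambda>.\<close>

lemma hyperbolic_power_dist_le_curve_length:
  assumes p: "p \<in> hyperbolic_power" and p': "p' \<in> hyperbolic_power"
    and \<sigma>: "rectifiable_curve_in SL symmetric_space_tensor \<sigma>"
      "pathstart \<sigma> \<in> coset_embedding p" "pathfinish \<sigma> \<in> coset_embedding p'"
  shows "hyperbolic_power_dist p p'
           \<le> CARD('n) * (14 * curve_length symmetric_space_tensor \<sigma> + 1)"
proof -
  define L where "L = curve_length symmetric_space_tensor \<sigma>"
  have pos: "Im (p $ i) > 0" "Im (p' $ i) > 0" for i
    using p p' by (auto simp: hyperbolic_power_def hyperbolic_plane_def)
  have L: "L \<ge> 0"
    unfolding L_def by (intro curve_length_nonneg symmetric_space_tensor_nonneg)
  have lip: "\<bar>ln (norm (w v* solvable_matrix p')) - ln (norm (w v* solvable_matrix p))\<bar> \<le> L"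
    if "w \<noteq> 0" for w
    using ln_norm_le_curve_length[OF \<sigma>(1) that] \<sigma>(2,3) by (simp add: norm_vector_coset L_def)
  have scale: "\<bar>ln (det_scale p') - ln (det_scale p)\<bar> \<le> L"
    using lip[of "axis l 1"] by (simp add: norm_axis_l_solvable_matrix)
  have ratio: "\<bar>ln (cmod (p' $ i - of_real t)) - ln (cmod (p $ i - of_real t))\<bar> \<le> 2 * L" for i t
  proof -
    have "(axis (e i) 1 - t *\<^sub>R axis l 1 :: real ^ 'm) $ e i \<noteq> 0"
      by (simp, simp add: axis_def)
    then have "axis (e i) 1 - t *\<^sub>R axis l 1 \<noteq> (0 :: real ^ 'm)"
      by (metis zero_index)
    from lip[OF this]
    have "\<bar>ln (det_scale p' * cmod (p' $ i - of_real t)) - ln (det_scale p * cmod (p $ i - of_real t))\<bar> \<le> L"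
      by (simp only: norm_axis_e_solvable_matrix)
    moreover have "p $ i \<noteq> of_real t" "p' $ i \<noteq> of_real t"
      using pos[of i] by auto
    ultimately show ?thesis
      using scale det_scale_pos[of p] det_scale_pos[of p'] by (simp add: ln_mult_pos)
  qed
  \<comment> \<open>For \<open>t = Re z\<close> the distance from \<open>z\<close> to
    \<open>t\<close> is the height of \<open>z\<close>. The height of \<open>z'\<close> and the
    horizontal offset are both at most the distance from \<open>z'\<close> to
    \<open>t\<close>.\<close>
  have im: "ln (Im z') \<le> 2 * L + ln (Im z)" and re: "\<bar>Re z' - Re z\<bar> \<le> exp (2 * L + ln (Im z))"
    if r: "\<bar>ln (cmod (z' - of_real (Re z))) - ln (cmod (z - of_real (Re z)))\<bar> \<le> 2 * L"
      and z: "Im z > 0" "Im z' > 0" for z z'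
  proof -
    have "z - of_real (Re z) = \<i> * of_real (Im z)"
      by (simp add: complex_eq_iff)
    then have "cmod (z - of_real (Re z)) = Im z"
      using z by (simp add: norm_mult)
    then have le: "ln (cmod (z' - of_real (Re z))) \<le> 2 * L + ln (Im z)"
      using r by simp
    have cpos: "cmod (z' - of_real (Re z)) > 0"
      using z by auto
    have "Im z' \<le> cmod (z' - of_real (Re z))"
      using abs_Im_le_cmod[of "z' - of_real (Re z)"] by simp
    then show "ln (Im z') \<le> 2 * L + ln (Im z)"
      using z le cpos by (meson ln_le_cancel_iff order_trans)
    have "\<bar>Re z' - Re z\<bar> \<le> cmod (z' - of_real (Re z))"
      using abs_Re_le_cmod[of "z' - of_real (Re z)"] by simp
    also have "\<dots> = exp (ln (cmod (z' - of_real (Re z))))"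
      using cpos by simp
    also have "\<dots> \<le> exp (2 * L + ln (Im z))"
      using le by simp
    finally show "\<bar>Re z' - Re z\<bar> \<le> exp (2 * L + ln (Im z))" .
  qed
  have im1: "ln (Im (p' $ i)) \<le> 2 * L + ln (Im (p $ i))"
    and re1: "\<bar>Re (p' $ i) - Re (p $ i)\<bar> \<le> exp (2 * L + ln (Im (p $ i)))"
    and im2: "ln (Im (p $ i)) \<le> 2 * L + ln (Im (p' $ i))"
    and re2: "\<bar>Re (p' $ i) - Re (p $ i)\<bar> \<le> exp (2 * L + ln (Im (p' $ i)))" for i
    using im[of "p' $ i" "p $ i"] re[of "p' $ i" "p $ i"] im[of "p $ i" "p' $ i"] re[of "p $ i" "p' $ i"]
      ratio[of i "Re (p $ i)"] ratio[of i "Re (p' $ i)"] pos[of i]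
    by (simp_all add: abs_minus_commute)
  \<comment> \<open>The offset is bounded through the smaller of the two heights, which is at most
    their geometric mean.\<close>
  have re3: "\<bar>Re (p' $ i) - Re (p $ i)\<bar> \<le> exp (2 * L + (ln (Im (p $ i)) + ln (Im (p' $ i))) / 2)" for i
  proof (cases "ln (Im (p $ i)) \<le> ln (Im (p' $ i))")
    case True
    then show ?thesis by (intro order_trans[OF re1[of i]]) simp
  next
    case False
    then show ?thesis by (intro order_trans[OF re2[of i]]) simp
  qed
  obtain \<gamma> where \<gamma>: "rectifiable_curve_in hyperbolic_power hyperbolic_power_tensor \<gamma>"
    "pathstart \<gamma> = p" "pathfinish \<gamma> = p'"
    "curve_length hyperbolic_power_tensor \<gamma> \<le> CARD('n) * (7 * (2 * L) + 1)"
  proof (rule hyperbolic_power_curve[OF p p'])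
    show "2 * L \<ge> 0" using L by simp
    show "\<bar>ln (Im (p' $ i)) - ln (Im (p $ i))\<bar> \<le> 2 * L" for i
      using im1[of i] im2[of i] by (simp add: abs_le_iff)
  qed (rule re3)
  have "hyperbolic_power_dist p p' \<le> curve_length hyperbolic_power_tensor \<gamma>"
    unfolding hyperbolic_power_dist_def
    using \<gamma> by (intro riemannian_dist_le_curve_length hyperbolic_power_tensor_nonneg) auto
  with \<gamma>(4) show ?thesis by (simp add: L_def)
qed

section \<open>The quasi-isometry constants\<close>

lemma coset_embedding_quasi_isometric:
  "\<exists>K C. quasi_isometric_embedding K C hyperbolic_power hyperbolic_power_dist
     SL_mod_SO SL_mod_SO_dist coset_embedding"
proof -
  \<comment> \<open>\<open>speed_factor\<close> serves the upper bound. For the lower bound,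
    \<open>n * (14 * L + 1)\<close> is at most \<open>14 * n * (L + 1)\<close>, which leads to the
    additive constant 1.\<close>
  define K where "K = max (14 * real CARD('n)) speed_factor"
  have n: "real CARD('n) \<ge> 1" by simp
  have K1: "K \<ge> 14 * real CARD('n)" and K2: "K \<ge> speed_factor"
    by (auto simp: K_def)
  have K: "K \<ge> 1" using n K1 by linarith
  have upper: "SL_mod_SO_dist (coset_embedding p) (coset_embedding p') \<le> K * hyperbolic_power_dist p p'"
    and lower: "hyperbolic_power_dist p p' / K - 1 \<le> SL_mod_SO_dist (coset_embedding p) (coset_embedding p')"
    if p: "p \<in> hyperbolic_power" and p': "p' \<in> hyperbolic_power" for p p' :: "complex ^ 'n"
  proof -
    \<comment> \<open>This curve and its image show that the infima defining both distances are over
      nonempty sets.\<close>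
    obtain \<gamma>\<^sub>0 where \<gamma>\<^sub>0: "rectifiable_curve_in hyperbolic_power hyperbolic_power_tensor \<gamma>\<^sub>0"
      "pathstart \<gamma>\<^sub>0 = p" "pathfinish \<gamma>\<^sub>0 = p'"
      using hyperbolic_power_connected[OF p p'] .
    have image: "pathstart (solvable_matrix \<circ> \<gamma>) \<in> coset_embedding p"
      "pathfinish (solvable_matrix \<circ> \<gamma>) \<in> coset_embedding p'"
      if "pathstart \<gamma> = p" "pathfinish \<gamma> = p'" for \<gamma>
      using that solvable_matrix_in_coset by (simp_all add: pathstart_compose pathfinish_compose)
    have "SL_mod_SO_dist (coset_embedding p) (coset_embedding p') / K \<le> hyperbolic_power_dist p p'"
      unfolding hyperbolic_power_dist_def
    proof (rule le_riemannian_dist)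
      fix \<gamma> assume \<gamma>: "rectifiable_curve_in hyperbolic_power hyperbolic_power_tensor \<gamma>"
        "pathstart \<gamma> \<in> {p}" "pathfinish \<gamma> \<in> {p'}"
      have "SL_mod_SO_dist (coset_embedding p) (coset_embedding p')
          \<le> curve_length symmetric_space_tensor (solvable_matrix \<circ> \<gamma>)"
        unfolding SL_mod_SO_dist_def using image \<gamma> solvable_matrix_curve(1)[OF \<gamma>(1)]
        by (intro riemannian_dist_le_curve_length symmetric_space_tensor_nonneg) auto
      also have "\<dots> \<le> speed_factor * curve_length hyperbolic_power_tensor \<gamma>"
        by (rule solvable_matrix_curve(2)[OF \<gamma>(1)])
      also have "\<dots> \<le> K * curve_length hyperbolic_power_tensor \<gamma>"
        by (intro mult_right_mono K2 curve_length_nonneg hyperbolic_power_tensor_nonneg)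
      finally show "SL_mod_SO_dist (coset_embedding p) (coset_embedding p') / K
          \<le> curve_length hyperbolic_power_tensor \<gamma>"
        using K by (simp add: field_simps)
    qed (use \<gamma>\<^sub>0 in auto)
    then show "SL_mod_SO_dist (coset_embedding p) (coset_embedding p') \<le> K * hyperbolic_power_dist p p'"
      using K by (simp add: field_simps)
    show "hyperbolic_power_dist p p' / K - 1 \<le> SL_mod_SO_dist (coset_embedding p) (coset_embedding p')"
      unfolding SL_mod_SO_dist_def
    proof (rule le_riemannian_dist)
      fix \<sigma> :: "real \<Rightarrow> real ^ 'm ^ 'm"
      assume \<sigma>: "rectifiable_curve_in SL symmetric_space_tensor \<sigma>"
        "pathstart \<sigma> \<in> coset_embedding p" "pathfinish \<sigma> \<in> coset_embedding p'"
      let ?L = "curve_length symmetric_space_tensor \<sigma>"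
      have "hyperbolic_power_dist p p' \<le> 14 * CARD('n) * (?L + 1)"
        using hyperbolic_power_dist_le_curve_length[OF p p' \<sigma>] by (simp add: algebra_simps)
      also have "\<dots> \<le> K * (?L + 1)"
        by (intro mult_right_mono K1 add_nonneg_nonneg curve_length_nonneg symmetric_space_tensor_nonneg)
          (use K1 in auto)
      finally show "hyperbolic_power_dist p p' / K - 1 \<le> ?L"
        using K by (simp add: field_simps)
    qed (use solvable_matrix_curve(1)[OF \<gamma>\<^sub>0(1)] image[OF \<gamma>\<^sub>0(2,3)] in auto)
  qed
  have "coset_embedding p \<in> SL_mod_SO" if "p \<in> hyperbolic_power" for p
    using solvable_matrix_in_SL[OF that] by (auto simp: SL_mod_SO_def coset_embedding_def)
  then have "quasi_isometric_embedding K 1 hyperbolic_power hyperbolic_power_dist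
     SL_mod_SO SL_mod_SO_dist coset_embedding"
    unfolding quasi_isometric_embedding_def
    using K lower upper by (simp add: Pi_iff add_increasing2)
  then show ?thesis by blast
qed

end

lemma quasi_isometric_embedding_exists:
  assumes "CARD('m::finite) = CARD('n::finite) + 1"
  shows "\<exists>(f :: complex ^ 'n \<Rightarrow> (real ^ 'm ^ 'm) set) K C.
           quasi_isometric_embedding K C hyperbolic_power hyperbolic_power_dist
             SL_mod_SO SL_mod_SO_dist f"
proof -
  \<comment> \<open>Any index may serve as the last one; its complement has as many elements as
    \<open>'n\<close>.\<close>
  fix l :: 'm
  have "card (UNIV :: 'n set) = card (- {l})"
    using assms by (simp only: Compl_eq_Diff_UNIV card_Diff_singleton[OF UNIV_I] add_diff_cancel_right')
  then obtain e where "bij_betw e (UNIV :: 'n set) (- {l})"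
    using finite_same_card_bij[OF finite finite] by blast
  then interpret last_index e l
    by unfold_locales (auto simp: bij_betw_def)
  show ?thesis
    using coset_embedding_quasi_isometric by blast
qed

theorem theorem1p6:
  shows "(\<exists>(f :: complex ^ 2 \<Rightarrow> (real ^ 3 ^ 3) set) K C.
            quasi_isometric_embedding K C hyperbolic_power hyperbolic_power_dist
              SL_mod_SO SL_mod_SO_dist f)
       \<and> (CARD('m::finite) = CARD('n::finite) + 1 \<longrightarrow>
          (\<exists>(f :: complex ^ 'n \<Rightarrow> (real ^ 'm ^ 'm) set) K C.
            quasi_isometric_embedding K C hyperbolic_power hyperbolic_power_dist
              SL_mod_SO SL_mod_SO_dist f))"
  using quasi_isometric_embedding_exists[where 'm = 3 and 'n = 2]
    quasi_isometric_embedding_exists[where 'm = 'm and 'n = 'n] by simp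

end
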